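(* Let $A\in\mathbb{R}^{m\times n}$, let $Q\in\mathbb{R}^{n\times n}$ be symmetric positive semidefinite, and at an arbitrary fixed iteration $k$ let $\Theta_k$ be a diagonal matrix with positive diagonal entries, and let $\rho_k,\delta_k,\mu_k,C_{E,k}>0$. Let $M_{AS,k}$, $P_{AS,k}$, and the numbers $\alpha_F,\beta_F,\beta_{NE}$ be defined from these data as in the context. Then the eigenvalues of $P_{AS,k}^{-1}M_{AS,k}$ lie in the union of the intervals \[I_-=\left[-\beta_F-\sqrt{\beta_{NE}},\,-\alpha_F\right],\qquad I_+=\left[\frac{1}{1+\beta_F},\,1+\sqrt{\beta_{NE}-1}\right].\]
   Context: Let $\tilde Q=\mathrm{diag}(Q)$ be the diagonal matrix with the same diagonal entries as $Q$. Define \[F_k=Q+\Theta_k^{-1}+\rho_kI_n,\qquad \tilde F_k=\tilde Q+\Theta_k^{-1}+\rho_kI_n,\qquad \tilde G_k=\tilde F_k^{-1},\qquad \tilde M_{NE,k}=A\tilde G_kA^T+\delta_kI_m .\] Let $E_k$ be the $n\times n$ diagonal matrix with $E_k^{(i,i)}=0$ if $\tilde G_k^{(i,i)}<C_{E,k}\min\{\mu_k,1\}$ and $E_k^{(i,i)}=\tilde G_k^{(i,i)}$ otherwise, and put $P_{NE,k}=AE_kA^T+\delta_kI_m$. Define the block matrices \[M_{AS,k}=\begin{bmatrix}-F_k & A^T\\ A&\delta_kI_m\end{bmatrix},\qquad P_{AS,k}=\begin{bmatrix}\tilde F_k&0\\0&P_{NE,k}\end{bmatrix}.\] Set $\hat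 F_k=\tilde F_k^{-1/2}F_k\tilde F_k^{-1/2}$ and $\hat M_{NE,k}=P_{NE,k}^{-1/2}\tilde M_{NE,k}P_{NE,k}^{-1/2}$ (symmetric positive definite), and \[\alpha_F=\lambda_{\min}(\hat F_k),\qquad \beta_F=\lambda_{\max}(\hat F_k),\qquad \beta_{NE}=\lambda_{\max}(\hat M_{NE,k}),\] where $\lambda_{\min},\lambda_{\max}$ denote the smallest and largest eigenvalues. (In the source, $k$ is an iteration index of an interior point--proximal method of multipliers for $\min_x c^Tx+\frac12x^TQx$ s.t. $Ax=b$, $x\ge0$; $\mu_k$ is the barrier parameter, $\rho_k,\delta_k$ are regularization parameters, and $\Theta_k=X_kZ_k^{-1}$, where $X_k,Z_k$ are diagonal matrices with positive diagonals.) *)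

theory Defs
  imports "HOL-Analysis.Analysis"
begin

definition eigenvalue :: "'a::field^'n^'n \<Rightarrow> 'a \<Rightarrow> bool" where
  "eigenvalue M l \<longleftrightarrow> (\<exists>v. v \<noteq> 0 \<and> M *v v = l *s v)"

text \<open>The spectrum of a real matrix is taken over the complex numbers, so that a matrix
  which is not symmetric is not assumed to have only real eigenvalues.\<close>

definition spectrum :: "real^'n^'n \<Rightarrow> complex set" where
  "spectrum M = {l. eigenvalue (map_matrix complex_of_real M) l}"

text \<open>Only meaningful for symmetric matrices, all of whose eigenvalues are real.\<close>

definition lambda_min :: "real^'n^'n \<Rightarrow> real" where
  "lambda_min M = Min {l. eigenvalue M l}"

definition lambda_max :: "real^'n^'n \<Rightarrow> real" where
  "lambda_max M = Max {l. eigenvalue M l}"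

definition pos_semidef :: "real^'n^'n \<Rightarrow> bool" where
  "pos_semidef M \<longleftrightarrow> transpose M = M \<and> (\<forall>x. 0 \<le> x \<bullet> (M *v x))"

definition is_diag :: "real^'n^'n \<Rightarrow> bool" where
  "is_diag M \<longleftrightarrow> (\<forall>i j. i \<noteq> j \<longrightarrow> M $ i $ j = 0)"

definition diag_part :: "real^'n^'n \<Rightarrow> real^'n^'n" where
  "diag_part M = (\<chi> i j. if i = j then M $ i $ i else 0)"

text \<open>The principal square root, which exists and is unique for positive semidefinite
  matrices.\<close>

definition mat_sqrt :: "real^'n^'n \<Rightarrow> real^'n^'n" where
  "mat_sqrt M = (THE S. pos_semidef S \<and> S ** S = M)"

definition inv_sqrt :: "real^'n^'n \<Rightarrow> real^'n^'n" where
  "inv_sqrt M = matrix_inv (mat_sqrt M)"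

definition block_matrix ::
  "real^'n^'n \<Rightarrow> real^'m^'n \<Rightarrow> real^'n^'m \<Rightarrow> real^'m^'m \<Rightarrow> real^('n + 'm)^('n + 'm)" where
  "block_matrix B11 B12 B21 B22 = (\<chi> i j.
     case i of
       Inl a \<Rightarrow> (case j of Inl b \<Rightarrow> B11 $ a $ b | Inr b \<Rightarrow> B12 $ a $ b)
     | Inr a \<Rightarrow> (case j of Inl b \<Rightarrow> B21 $ a $ b | Inr b \<Rightarrow> B22 $ a $ b))"

text \<open>Below, \<open>A\<close> is the constraint matrix with rows indexed by \<open>'m\<close> and columns by \<open>'n\<close>.
  A suffix \<open>t\<close> stands for a tilde and a suffix \<open>h\<close> for a hat. The iteration index is fixed
  and therefore omitted.\<close>

definition F_mat :: "real^'n^'n \<Rightarrow> real^'n^'n \<Rightarrow> real \<Rightarrow> real^'n^'n" where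
  "F_mat Q \<Theta> \<rho> = Q + matrix_inv \<Theta> + \<rho> *\<^sub>R mat 1"

definition Ft_mat :: "real^'n^'n \<Rightarrow> real^'n^'n \<Rightarrow> real \<Rightarrow> real^'n^'n" where
  "Ft_mat Q \<Theta> \<rho> = diag_part Q + matrix_inv \<Theta> + \<rho> *\<^sub>R mat 1"

definition Gt_mat :: "real^'n^'n \<Rightarrow> real^'n^'n \<Rightarrow> real \<Rightarrow> real^'n^'n" where
  "Gt_mat Q \<Theta> \<rho> = matrix_inv (Ft_mat Q \<Theta> \<rho>)"

definition MNEt_mat ::
  "real^'n^'m \<Rightarrow> real^'n^'n \<Rightarrow> real^'n^'n \<Rightarrow> real \<Rightarrow> real \<Rightarrow> real^'m^'m" where
  "MNEt_mat A Q \<Theta> \<rho> \<delta> = A ** Gt_mat Q \<Theta> \<rho> ** transpose A + \<delta> *\<^sub>R mat 1"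

definition E_mat ::
  "real^'n^'n \<Rightarrow> real^'n^'n \<Rightarrow> real \<Rightarrow> real \<Rightarrow> real \<Rightarrow> real^'n^'n" where
  "E_mat Q \<Theta> \<rho> \<mu> C = (\<chi> i j.
     if i = j then
       (if Gt_mat Q \<Theta> \<rho> $ i $ i < C * min \<mu> 1 then 0 else Gt_mat Q \<Theta> \<rho> $ i $ i)
     else 0)"

definition PNE_mat ::
  "real^'n^'m \<Rightarrow> real^'n^'n \<Rightarrow> real^'n^'n \<Rightarrow> real \<Rightarrow> real \<Rightarrow> real \<Rightarrow> real \<Rightarrow> real^'m^'m" where
  "PNE_mat A Q \<Theta> \<rho> \<delta> \<mu> C = A ** E_mat Q \<Theta> \<rho> \<mu> C ** transpose A + \<delta> *\<^sub>R mat 1"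

definition MAS_mat ::
  "real^'n^'m \<Rightarrow> real^'n^'n \<Rightarrow> real^'n^'n \<Rightarrow> real \<Rightarrow> real \<Rightarrow> real^('n + 'm)^('n + 'm)" where
  "MAS_mat A Q \<Theta> \<rho> \<delta> =
     block_matrix (- F_mat Q \<Theta> \<rho>) (transpose A) A (\<delta> *\<^sub>R mat 1)"

definition PAS_mat ::
  "real^'n^'m \<Rightarrow> real^'n^'n \<Rightarrow> real^'n^'n \<Rightarrow> real \<Rightarrow> real \<Rightarrow> real \<Rightarrow> real
     \<Rightarrow> real^('n + 'm)^('n + 'm)" where
  "PAS_mat A Q \<Theta> \<rho> \<delta> \<mu> C =
     block_matrix (Ft_mat Q \<Theta> \<rho>) 0 0 (PNE_mat A Q \<Theta> \<rho> \<delta> \<mu> C)"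

definition Fh_mat :: "real^'n^'n \<Rightarrow> real^'n^'n \<Rightarrow> real \<Rightarrow> real^'n^'n" where
  "Fh_mat Q \<Theta> \<rho> =
     inv_sqrt (Ft_mat Q \<Theta> \<rho>) ** F_mat Q \<Theta> \<rho> ** inv_sqrt (Ft_mat Q \<Theta> \<rho>)"

definition MNEh_mat ::
  "real^'n^'m \<Rightarrow> real^'n^'n \<Rightarrow> real^'n^'n \<Rightarrow> real \<Rightarrow> real \<Rightarrow> real \<Rightarrow> real \<Rightarrow> real^'m^'m" where
  "MNEh_mat A Q \<Theta> \<rho> \<delta> \<mu> C =
     inv_sqrt (PNE_mat A Q \<Theta> \<rho> \<delta> \<mu> C) ** MNEt_mat A Q \<Theta> \<rho> \<delta>
       ** inv_sqrt (PNE_mat A Q \<Theta> \<rho> \<delta> \<mu> C)"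

definition alpha_F :: "real^'n^'n \<Rightarrow> real^'n^'n \<Rightarrow> real \<Rightarrow> real" where
  "alpha_F Q \<Theta> \<rho> = lambda_min (Fh_mat Q \<Theta> \<rho>)"

definition beta_F :: "real^'n^'n \<Rightarrow> real^'n^'n \<Rightarrow> real \<Rightarrow> real" where
  "beta_F Q \<Theta> \<rho> = lambda_max (Fh_mat Q \<Theta> \<rho>)"

definition beta_NE ::
  "real^'n^'m \<Rightarrow> real^'n^'n \<Rightarrow> real^'n^'n \<Rightarrow> real \<Rightarrow> real \<Rightarrow> real \<Rightarrow> real \<Rightarrow> real" where
  "beta_NE A Q \<Theta> \<rho> \<delta> \<mu> C = lambda_max (MNEh_mat A Q \<Theta> \<rho> \<delta> \<mu> C)"

end

theory Submission
  imports Defs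
begin

text \<open>Write \<open>F\<close>, \<open>Ft\<close>, \<open>P\<close>, \<open>M\<close> for $F_k$, $\tilde F_k$, $P_{NE,k}$, $\tilde M_{NE,k}$. Since
  $P_{AS,k}$ is positive definite and $M_{AS,k}$ is symmetric, an eigenvalue of the
  preconditioned matrix is a real \<open>r\<close> for which some real \<open>(x, y) \<noteq> 0\<close> satisfies

  \<open>- F x + A\<^sup>T y = r Ft x\<close> and \<open>A x + \<delta> y = r P y\<close>.

  The square roots in the hatted matrices only express Rayleigh quotients relative to \<open>Ft\<close>
  and \<open>P\<close>: \<open>\<alpha>\<close> and \<open>\<beta>\<close> are the best constants in \<open>\<alpha> Ft \<le> F \<le> \<beta> Ft\<close>, and \<open>M \<le> B P\<close> with
  \<open>B = \<beta>\<^sub>N\<^sub>E\<close> (lemma \<open>inv_sqrt_congruence\<close>). Moreover \<open>\<delta> I \<le> P \<le> M\<close>, because dropping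
  diagonal entries of \<open>Gt = Ft\<^sup>-\<^sup>1\<close> lowers the quadratic form of \<open>A Gt A\<^sup>T\<close>. After this
  translation the argument uses no square root of a matrix.

  Put \<open>f = x \<bullet> Ft x\<close>, \<open>p = y \<bullet> P y\<close>, \<open>s = x \<bullet> A\<^sup>T y\<close>, \<open>w = A\<^sup>T y \<bullet> Gt A\<^sup>T y\<close> and
  \<open>e = \<delta> (y \<bullet> y)\<close>, so that \<open>e \<le> p \<le> w + e \<le> B p\<close>.

  If \<open>r \<le> - \<alpha>\<close>, only the lower end of the negative interval is at stake. It comes from
  pairing the two equations with \<open>x\<close> and \<open>y\<close> and adding: the mixed term \<open>2 s\<close> is bounded by
  \<open>\<bar>s\<bar> \<le> sqrt (f w) \<le> sqrt B (f + p) / 2\<close> (lemma \<open>negative_branch_bound\<close>).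

  If \<open>r > - \<alpha>\<close>, the matrix \<open>H = F + r Ft\<close> is positive definite and \<open>H x = A\<^sup>T y\<close>, so
  \<open>s = A\<^sup>T y \<bullet> H\<^sup>-\<^sup>1 A\<^sup>T y\<close>, which lies between \<open>w / (r + \<beta>)\<close> and \<open>w / (r + \<alpha>)\<close>. The second
  equation becomes \<open>r p = s + e\<close>, the Schur complement equation; it forces \<open>r > 0\<close>, and
  elementary estimates give the positive interval (lemma \<open>positive_branch_bounds\<close>). The two
  sandwich bounds on \<open>s\<close> need no inverse of \<open>H\<close>: each is one application of the
  Cauchy--Schwarz inequality, the upper one for \<open>Ft\<close> and the lower one for \<open>H\<close>.

  The spectral theorem for real symmetric matrices is proved below, since it is needed for
  the existence and uniqueness of \<open>mat_sqrt\<close> and for the finiteness of the sets behind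
  \<open>lambda_min\<close> and \<open>lambda_max\<close>.\<close>

section \<open>Self-adjoint maps\<close>

lemma dot_matrix_mult_transpose:
  fixes M :: "real^'n^'m"
  shows "x \<bullet> (M *v y) = (transpose M *v x) \<bullet> y"
  by (simp add: dot_lmul_matrix)

lemma symmetric_dot_commute:
  fixes M :: "real^'n^'n"
  assumes "transpose M = M"
  shows "(M *v x) \<bullet> y = x \<bullet> (M *v y)"
  by (metis assms dot_matrix_mult_transpose)

text \<open>The quadratic \<open>t \<mapsto> (u + t v) \<bullet> f (u + t v)\<close> is nonnegative, hence has nonpositive
  discriminant. The form may be degenerate; this matters in the next lemma. Positivity is
  only assumed on a subspace, so that the lemma can be used on invariant subspaces.\<close>

lemma Cauchy_Schwarz_psd_form:
  fixes f :: "'a::real_inner \<Rightarrow> 'a"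
  assumes lin: "linear f" and S: "subspace S"
    and psd: "\<And>x. x \<in> S \<Longrightarrow> 0 \<le> x \<bullet> f x"
    and sym: "\<And>x y. f x \<bullet> y = x \<bullet> f y"
    and u: "u \<in> S" and v: "v \<in> S"
  shows "(u \<bullet> f v)\<^sup>2 \<le> (u \<bullet> f u) * (v \<bullet> f v)"
proof -
  define a b c where "a = u \<bullet> f u" and "b = u \<bullet> f v" and "c = v \<bullet> f v"
  have uv: "v \<bullet> f u = b" using sym[of v u] by (simp add: b_def inner_commute)
  have q: "0 \<le> a + 2 * t * b + t\<^sup>2 * c" for t
  proof -
    have "0 \<le> (u + t *\<^sub>R v) \<bullet> f (u + t *\<^sub>R v)"
      using S u v by (intro psd) (simp add: subspace_add subspace_scale)
    also have "\<dots> = a + 2 * t * b + t\<^sup>2 * c"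
      by (simp add: linear_add[OF lin] linear_scale[OF lin] inner_add_left inner_add_right uv
          power2_eq_square a_def b_def[symmetric] c_def algebra_simps)
    finally show ?thesis .
  qed
  have "0 \<le> c" using psd[OF v] by (simp add: c_def)
  have "b\<^sup>2 \<le> a * c"
  proof (cases "c = 0")
    case True
    have "b = 0"
    proof (rule ccontr)
      assume "b \<noteq> 0"
      then show False using q[of "- (a + 1) / (2 * b)"] True by (simp add: field_simps)
    qed
    then show ?thesis using True by simp
  next
    case False
    with \<open>0 \<le> c\<close> have "0 < c" by simp
    have "0 \<le> c * (a + 2 * (- b / c) * b + (- b / c)\<^sup>2 * c)"
      using mult_nonneg_nonneg[OF \<open>0 \<le> c\<close> q[of "- b / c"]] .
    also have "\<dots> = a * c - b\<^sup>2"
      using False by (simp add: field_simps power2_eq_square)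
    finally show ?thesis by simp
  qed
  then show ?thesis by (simp add: a_def b_def c_def)
qed

text \<open>A maximiser \<open>v\<close> of the quadratic form on the unit sphere, with value \<open>l\<close>, makes
  \<open>g = l I - f\<close> positive semidefinite with \<open>v \<bullet> g v = 0\<close>. Cauchy--Schwarz for \<open>g\<close> then forces
  \<open>g v = 0\<close>, without any differentiation.\<close>

lemma Rayleigh_maximum_is_eigenvector:
  fixes f :: "'a::euclidean_space \<Rightarrow> 'a"
  assumes lin: "linear f" and S: "subspace S" and nz: "S \<noteq> {0}"
    and inv: "f ` S \<subseteq> S"
    and sym: "\<And>x y. f x \<bullet> y = x \<bullet> f y"
  obtains v where "v \<in> S" "norm v = 1" "f v = (v \<bullet> f v) *\<^sub>R v"
    "\<And>x. x \<in> S \<Longrightarrow> x \<bullet> f x \<le> (v \<bullet> f v) * (x \<bullet> x)"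
proof -
  let ?K = "sphere 0 1 \<inter> S"
  have unit: "x /\<^sub>R norm x \<in> ?K" if "x \<in> S" "x \<noteq> 0" for x
    using that S by (simp add: subspace_scale)
  have "compact ?K" by (simp add: S closed_subspace compact_Int_closed)
  moreover have "?K \<noteq> {}"
    using nz unit subspace_0[OF S] by blast
  moreover have "continuous_on ?K (\<lambda>x. x \<bullet> f x)"
    by (intro continuous_intros linear_continuous_on linear_conv_bounded_linear[THEN iffD1] lin)
  ultimately obtain v where v: "v \<in> ?K" and vmax: "\<And>x. x \<in> ?K \<Longrightarrow> x \<bullet> f x \<le> v \<bullet> f v"
    using continuous_attains_sup by (metis (no_types, lifting))
  define l where "l = v \<bullet> f v"
  have vv: "v \<bullet> v = 1" using v by (simp add: norm_eq_1)
  have R: "x \<bullet> f x \<le> l * (x \<bullet> x)" if "x \<in> S" for x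
  proof (cases "x = 0")
    case True
    then show ?thesis by simp
  next
    case False
    have "(x /\<^sub>R norm x) \<bullet> f (x /\<^sub>R norm x) \<le> l"
      using vmax[OF unit[OF that False]] by (simp add: l_def)
    moreover have "(x /\<^sub>R norm x) \<bullet> f (x /\<^sub>R norm x) = (x \<bullet> f x) / (x \<bullet> x)"
      by (simp add: linear_scale[OF lin] dot_square_norm power2_eq_square divide_simps)
    ultimately show ?thesis using False by (simp add: divide_le_eq)
  qed
  let ?g = "\<lambda>x. l *\<^sub>R x - f x"
  have gv: "?g v \<in> S" using v inv S by (auto intro!: subspace_diff subspace_scale)
  have ling: "linear ?g"
    by (intro linear_compose_sub lin linear_scale_self)
  have "(?g v \<bullet> ?g v)\<^sup>2 \<le> (?g v \<bullet> ?g (?g v)) * (v \<bullet> ?g v)"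
  proof (rule Cauchy_Schwarz_psd_form[OF ling S])
    show "0 \<le> x \<bullet> ?g x" if "x \<in> S" for x using R[OF that] by (simp add: inner_diff_right)
    show "?g x \<bullet> y = x \<bullet> ?g y" for x y by (simp add: inner_diff_right inner_diff_left sym)
  qed (use gv v in auto)
  also have "v \<bullet> ?g v = 0" by (simp add: inner_diff_right vv l_def)
  finally have "?g v = 0" by simp
  then have "f v = (v \<bullet> f v) *\<^sub>R v" by (simp add: l_def)
  with that[of v] v R show ?thesis by (simp add: l_def)
qed

text \<open>The spectral theorem, by induction on the dimension: split off one eigenvector \<open>v\<close>; its
  orthogonal complement inside \<open>S\<close> is again invariant.\<close>

lemma selfadjoint_orthonormal_eigenbasis:
  fixes f :: "'a::euclidean_space \<Rightarrow> 'a"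
  assumes lin: "linear f" and sym: "\<And>x y. f x \<bullet> y = x \<bullet> f y"
    and "subspace S" and "f ` S \<subseteq> S"
  shows "\<exists>B. pairwise orthogonal B \<and> (\<forall>b\<in>B. norm b = 1 \<and> f b = (b \<bullet> f b) *\<^sub>R b) \<and> span B = S"
  using assms(3,4)
proof (induction "dim S" arbitrary: S rule: less_induct)
  case less
  show ?case
  proof (cases "S = {0}")
    case True
    then show ?thesis by (intro exI[of _ "{}"]) auto
  next
    case False
    then obtain v where v: "v \<in> S" "norm v = 1" "f v = (v \<bullet> f v) *\<^sub>R v"
      using Rayleigh_maximum_is_eigenvector[OF lin less.prems(1) _ less.prems(2) sym] by metis
    have vv: "v \<bullet> v = 1" using v by (simp add: norm_eq_1)
    define T where "T = S \<inter> {x. v \<bullet> x = 0}"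
    have T: "subspace T"
      unfolding T_def by (intro subspace_inter less.prems subspace_hyperplane)
    have "v \<notin> T" using vv by (simp add: T_def)
    then have "T \<subset> S" using v(1) unfolding T_def by blast
    then have "dim T < dim S"
      using T less.prems(1) by (intro dim_psubset) (simp add: span_eq_iff[THEN iffD2])
    moreover have "f ` T \<subseteq> T"
    proof -
      have "v \<bullet> f x = 0" if "v \<bullet> x = 0" for x
        using that sym[of v x] v(3) by (metis inner_scaleR_left mult_zero_right)
      then show ?thesis using less.prems(2) by (auto simp: T_def)
    qed
    ultimately obtain B where B: "pairwise orthogonal B"
      "\<forall>b\<in>B. norm b = 1 \<and> f b = (b \<bullet> f b) *\<^sub>R b" "span B = T"
      using less.hyps[of T] T by blast
    have "B \<subseteq> T" using B(3) span_superset by blast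
    then have "pairwise orthogonal (insert v B)"
      using B(1) by (auto simp: pairwise_insert T_def orthogonal_def inner_commute)
    moreover have "span (insert v B) = S"
    proof
      show "span (insert v B) \<subseteq> S"
        using \<open>B \<subseteq> T\<close> \<open>T \<subset> S\<close> v less.prems(1) by (intro span_minimal) auto
      show "S \<subseteq> span (insert v B)"
      proof
        fix x assume "x \<in> S"
        then have "x - (v \<bullet> x) *\<^sub>R v \<in> T"
          using v less.prems(1) by (simp add: T_def inner_diff_right vv subspace_diff subspace_scale)
        then show "x \<in> span (insert v B)"
          using B(3) by (auto simp: span_insert)
      qed
    qed
    ultimately show ?thesis using B(2) v by (intro exI[of _ "insert v B"]) auto
  qed
qed

section \<open>Positive definite matrices and their square roots\<close>

definition pos_def :: "real^'n^'n \<Rightarrow> bool" where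
  "pos_def M \<longleftrightarrow> transpose M = M \<and> (\<forall>x. x \<noteq> 0 \<longrightarrow> 0 < x \<bullet> (M *v x))"

lemma pos_def_symmetric: "pos_def M \<Longrightarrow> transpose M = M"
  by (simp add: pos_def_def)

lemma pos_def_pos: "pos_def M \<Longrightarrow> x \<noteq> 0 \<Longrightarrow> 0 < x \<bullet> (M *v x)"
  by (simp add: pos_def_def)

lemma pos_def_imp_pos_semidef: "pos_def M \<Longrightarrow> pos_semidef M"
  unfolding pos_def_def pos_semidef_def
  by (metis inner_zero_left less_eq_real_def)

lemma pos_def_nonneg: "pos_def M \<Longrightarrow> 0 \<le> x \<bullet> (M *v x)"
  using pos_def_imp_pos_semidef pos_semidef_def by blast

lemma invertible_matrix_inv:
  fixes M :: "real^'n^'n"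
  assumes "invertible M"
  shows "M ** matrix_inv M = mat 1" "matrix_inv M ** M = mat 1"
  using someI_ex[OF assms[unfolded invertible_def]] by (simp_all add: matrix_inv_def)

lemma matrix_inv_eqI:
  fixes M :: "real^'n^'n"
  assumes "M ** N = mat 1"
  shows "matrix_inv M = N"
  by (metis assms invertible_matrix_inv(2) invertible_right_inverse matrix_mul_assoc
      matrix_mul_lid matrix_mul_rid)

lemma pos_def_invertible:
  assumes "pos_def M"
  shows "invertible M"
  unfolding invertible_left_inverse matrix_left_invertible_ker
  using pos_def_pos[OF assms] by (metis inner_zero_right less_irrefl)

text \<open>In an orthonormal eigenbasis, take the square roots of the eigenvalues.\<close>

lemma pos_semidef_sqrt_exists:
  fixes M :: "real^'n^'n"
  assumes "pos_semidef M"
  shows "\<exists>S. pos_semidef S \<and> S ** S = M"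
proof -
  have sym: "(M *v x) \<bullet> y = x \<bullet> (M *v y)" and psd: "0 \<le> x \<bullet> (M *v x)" for x y
    using assms symmetric_dot_commute by (auto simp: pos_semidef_def)
  obtain B where B: "pairwise orthogonal B" "span B = UNIV"
    and eig: "\<And>b. b \<in> B \<Longrightarrow> norm b = 1 \<and> M *v b = (b \<bullet> (M *v b)) *\<^sub>R b"
    using selfadjoint_orthonormal_eigenbasis[of "(*v) M" UNIV] sym by auto
  have fin: "finite B" using B(1) by (rule pairwise_orthogonal_imp_finite)
  define r where "r b = sqrt (b \<bullet> (M *v b))" for b
  define g where "g x = (\<Sum>b\<in>B. (r b * (x \<bullet> b)) *\<^sub>R b)" for x
  have expand: "(\<Sum>b\<in>B. (x \<bullet> b) *\<^sub>R b) = x" for x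
    using orthonormal_basis_expand[OF B(1) _ _ fin] eig B(2) by blast
  have ling: "linear g"
    by (rule linearI)
      (simp_all add: g_def inner_add_left algebra_simps sum.distrib scaleR_sum_right)
  have lin: "linear ((*v) M)" by simp
  have gb: "g b = r b *\<^sub>R b" if "b \<in> B" for b
  proof -
    have "g b = (\<Sum>c\<in>B. if c = b then r b *\<^sub>R b else 0)"
      unfolding g_def using that B(1) eig
      by (intro sum.cong) (auto simp: pairwise_def orthogonal_def norm_eq_1)
    then show ?thesis using that fin by simp
  qed
  have gg: "g (g x) = M *v x" for x
  proof -
    have "g (g x) = (\<Sum>b\<in>B. (r b * (x \<bullet> b)) *\<^sub>R g b)"
      by (subst (2) g_def) (simp add: linear_sum[OF ling] linear_scale[OF ling])
    also have "\<dots> = (\<Sum>b\<in>B. (x \<bullet> b) *\<^sub>R (M *v b))"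
    proof (rule sum.cong)
      fix b assume b: "b \<in> B"
      have "r b * r b = b \<bullet> (M *v b)" using psd by (simp add: r_def)
      then have "M *v b = (r b * r b) *\<^sub>R b" using eig[OF b] by simp
      then show "(r b * (x \<bullet> b)) *\<^sub>R g b = (x \<bullet> b) *\<^sub>R (M *v b)"
        by (simp add: gb[OF b] mult_ac)
    qed simp
    also have "\<dots> = M *v (\<Sum>b\<in>B. (x \<bullet> b) *\<^sub>R b)"
      by (simp add: linear_sum[OF lin] linear_scale[OF lin])
    finally show ?thesis by (simp add: expand)
  qed
  have mg: "matrix g *v x = g x" for x using ling by (simp add: matrix_works)
  have gsym: "g x \<bullet> y = x \<bullet> g y" for x y
    by (simp add: g_def inner_sum_left inner_sum_right inner_commute mult_ac)
  have "transpose (matrix g) = matrix g"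
  proof -
    have "adjoint g = g" using gsym by (intro adjoint_unique) simp
    then show ?thesis using matrix_adjoint[OF ling] by simp
  qed
  moreover have "0 \<le> x \<bullet> g x" for x
  proof -
    have "x \<bullet> g x = (\<Sum>b\<in>B. r b * (x \<bullet> b)\<^sup>2)"
      by (simp add: g_def inner_sum_right power2_eq_square mult.assoc)
    then show ?thesis by (simp add: r_def psd sum_nonneg)
  qed
  moreover have "matrix g ** matrix g = M"
    by (simp add: matrix_eq matrix_vector_mul_assoc[symmetric] mg gg)
  ultimately show ?thesis
    by (intro exI[of _ "matrix g"]) (simp add: pos_semidef_def mg)
qed

text \<open>If \<open>b\<close> is an eigenvector of \<open>S - T\<close> with eigenvalue \<open>l\<close>, then
  \<open>0 = |S b|\<^sup>2 - |T b|\<^sup>2 = l (b \<bullet> S b + b \<bullet> T b)\<close>. Either \<open>l = 0\<close>, or both forms vanish at \<open>b\<close>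
  and again \<open>l = 0\<close>. So the symmetric matrix \<open>S - T\<close> has only the eigenvalue zero.\<close>

lemma pos_semidef_sqrt_unique:
  fixes S T :: "real^'n^'n"
  assumes S: "pos_semidef S" and T: "pos_semidef T" and eq: "S ** S = T ** T"
  shows "S = T"
proof -
  have symS: "(S *v x) \<bullet> y = x \<bullet> (S *v y)" and symT: "(T *v x) \<bullet> y = x \<bullet> (T *v y)" for x y
    using S T symmetric_dot_commute by (auto simp: pos_semidef_def)
  have psd: "0 \<le> x \<bullet> (S *v x)" "0 \<le> x \<bullet> (T *v x)" for x
    using S T by (auto simp: pos_semidef_def)
  let ?D = "\<lambda>x. S *v x - T *v x"
  have lin: "linear ?D" by (intro linear_compose_sub) simp_all
  obtain B where B: "pairwise orthogonal B" "span B = UNIV"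
    and eig: "\<And>b. b \<in> B \<Longrightarrow> norm b = 1 \<and> ?D b = (b \<bullet> ?D b) *\<^sub>R b"
    using selfadjoint_orthonormal_eigenbasis[OF lin, of UNIV]
    by (auto simp: inner_diff_left inner_diff_right symS symT)
  have "?D b = 0" if b: "b \<in> B" for b
  proof -
    define l where "l = b \<bullet> ?D b"
    have Db: "?D b = l *\<^sub>R b" using eig[OF b] by (simp add: l_def)
    have "(S *v b) \<bullet> (S *v b) = (T *v b) \<bullet> (T *v b)"
      by (simp add: symS symT matrix_vector_mul_assoc eq)
    then have "?D b \<bullet> (S *v b + T *v b) = 0"
      by (simp add: inner_diff_left inner_diff_right inner_add_right inner_add_left inner_commute)
    then have "l * (b \<bullet> (S *v b) + b \<bullet> (T *v b)) = 0"
      unfolding Db by (simp add: inner_add_right distrib_left)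
    then have "l = 0 \<or> b \<bullet> (S *v b) + b \<bullet> (T *v b) = 0"
      by (simp only: mult_eq_0_iff)
    then have "l = 0"
      using psd[of b] by (auto simp: l_def inner_diff_right)
    then show ?thesis using Db by simp
  qed
  then have "?D x = 0" for x
    using linear_eq_on_span[OF lin module_hom_zero, of B x] B(2) by auto
  then show ?thesis by (simp add: matrix_eq)
qed

lemma mat_sqrt:
  assumes "pos_semidef M"
  shows "pos_semidef (mat_sqrt M)" "mat_sqrt M ** mat_sqrt M = M"
proof -
  have "\<exists>!S. pos_semidef S \<and> S ** S = M"
    using pos_semidef_sqrt_exists[OF assms] pos_semidef_sqrt_unique by metis
  then have "pos_semidef (mat_sqrt M) \<and> mat_sqrt M ** mat_sqrt M = M"
    unfolding mat_sqrt_def by (rule theI')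
  then show "pos_semidef (mat_sqrt M)" "mat_sqrt M ** mat_sqrt M = M" by simp_all
qed

lemma inv_sqrt:
  assumes "pos_def M"
  shows "transpose (inv_sqrt M) = inv_sqrt M" "inv_sqrt M ** mat_sqrt M = mat 1"
proof -
  note S = mat_sqrt[OF pos_def_imp_pos_semidef[OF assms]]
  have "x = 0" if "mat_sqrt M *v x = 0" for x
  proof -
    have "M *v x = 0"
      using that by (metis S(2) matrix_vector_mul_assoc matrix_vector_mult_0_right)
    then show ?thesis using pos_def_pos[OF assms] by (metis inner_zero_right less_irrefl)
  qed
  then have inv: "invertible (mat_sqrt M)"
    unfolding invertible_left_inverse matrix_left_invertible_ker by blast
  then show "inv_sqrt M ** mat_sqrt M = mat 1"
    by (simp add: inv_sqrt_def invertible_matrix_inv)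
  have "mat_sqrt M ** transpose (inv_sqrt M) = mat 1"
    using S(1) \<open>inv_sqrt M ** mat_sqrt M = mat 1\<close>
    by (metis matrix_transpose_mul pos_semidef_def transpose_mat)
  then show "transpose (inv_sqrt M) = inv_sqrt M"
    unfolding inv_sqrt_def using matrix_inv_eqI by fastforce
qed

section \<open>Extreme eigenvalues and Rayleigh quotients\<close>

text \<open>Needed because \<open>Max\<close> and \<open>Min\<close> are unspecified on infinite sets. Every eigenvalue is one
  of those of a fixed orthonormal eigenbasis, as its eigenvector cannot be orthogonal to the
  whole basis.\<close>

lemma symmetric_finite_eigenvalues:
  fixes M :: "real^'n^'n"
  assumes "transpose M = M"
  shows "finite {l. eigenvalue M l}"
proof -
  have sym: "(M *v x) \<bullet> y = x \<bullet> (M *v y)" for x y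
    using assms symmetric_dot_commute by blast
  obtain B where B: "pairwise orthogonal B" "span B = UNIV"
    and eig: "\<And>b. b \<in> B \<Longrightarrow> norm b = 1 \<and> M *v b = (b \<bullet> (M *v b)) *\<^sub>R b"
    using selfadjoint_orthonormal_eigenbasis[of "(*v) M" UNIV] sym by auto
  have "{l. eigenvalue M l} \<subseteq> (\<lambda>b. b \<bullet> (M *v b)) ` B"
  proof
    fix l assume "l \<in> {l. eigenvalue M l}"
    then obtain v where v: "v \<noteq> 0" "M *v v = l *\<^sub>R v"
      by (auto simp: eigenvalue_def scalar_mult_eq_scaleR)
    obtain b where b: "b \<in> B" "v \<bullet> b \<noteq> 0"
    proof (rule ccontr)
      assume "\<not> thesis"
      then have "\<And>b. b \<in> B \<Longrightarrow> orthogonal v b" using that by (auto simp: orthogonal_def)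
      then have "orthogonal v v" using B(2) orthogonal_to_span by blast
      then show False using v(1) by (simp add: orthogonal_def)
    qed
    have "l * (v \<bullet> b) = (b \<bullet> (M *v b)) * (v \<bullet> b)"
      using sym[of v b] v(2) eig[OF b(1)] by (metis inner_scaleR_left inner_scaleR_right)
    then show "l \<in> (\<lambda>b. b \<bullet> (M *v b)) ` B" using b by auto
  qed
  then show ?thesis
    using pairwise_orthogonal_imp_finite[OF B(1)] finite_subset by blast
qed

lemma Rayleigh_le_lambda_max:
  fixes M :: "real^'n^'n"
  assumes "transpose M = M"
  shows "x \<bullet> (M *v x) \<le> lambda_max M * (x \<bullet> x)"
proof -
  obtain v where v: "norm v = 1" "M *v v = (v \<bullet> (M *v v)) *\<^sub>R v"
    and R: "\<And>x. x \<bullet> (M *v x) \<le> (v \<bullet> (M *v v)) * (x \<bullet> x)"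
    using Rayleigh_maximum_is_eigenvector[of "(*v) M" UNIV] symmetric_dot_commute[OF assms]
    by (auto simp: UNIV_not_singleton)
  have "eigenvalue M (v \<bullet> (M *v v))"
    unfolding eigenvalue_def scalar_mult_eq_scaleR using v by (metis norm_zero zero_neq_one)
  then have "v \<bullet> (M *v v) \<le> lambda_max M"
    unfolding lambda_max_def using symmetric_finite_eigenvalues[OF assms] by simp
  then show ?thesis using R[of x] by (meson inner_ge_zero mult_right_mono order_trans)
qed

lemma lambda_min_le_Rayleigh:
  fixes M :: "real^'n^'n"
  assumes "transpose M = M"
  shows "lambda_min M * (x \<bullet> x) \<le> x \<bullet> (M *v x)" and "eigenvalue M (lambda_min M)"
proof -
  have lin: "linear (\<lambda>x. - (M *v x))" by (simp add: linear_compose_neg)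
  obtain v where v: "norm v = 1" "M *v v = (v \<bullet> (M *v v)) *\<^sub>R v"
    and R: "\<And>x. (v \<bullet> (M *v v)) * (x \<bullet> x) \<le> x \<bullet> (M *v x)"
    using Rayleigh_maximum_is_eigenvector[OF lin, of UNIV] symmetric_dot_commute[OF assms]
    by (auto simp: UNIV_not_singleton)
  have ev: "eigenvalue M (v \<bullet> (M *v v))"
    unfolding eigenvalue_def scalar_mult_eq_scaleR using v by (metis norm_zero zero_neq_one)
  have fin: "finite {l. eigenvalue M l}" using symmetric_finite_eigenvalues[OF assms] .
  then have "lambda_min M \<le> v \<bullet> (M *v v)"
    unfolding lambda_min_def using ev by simp
  then show "lambda_min M * (x \<bullet> x) \<le> x \<bullet> (M *v x)"
    using R[of x] by (meson inner_ge_zero mult_right_mono order_trans)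
  show "eigenvalue M (lambda_min M)"
    unfolding lambda_min_def using Min_in[OF fin] ev by auto
qed

lemma lambda_min_le_lambda_max:
  fixes M :: "real^'n^'n"
  assumes "transpose M = M"
  shows "lambda_min M \<le> lambda_max M"
proof -
  have "lambda_min M * ((1 :: real^'n) \<bullet> 1) \<le> lambda_max M * ((1 :: real^'n) \<bullet> 1)"
    using lambda_min_le_Rayleigh(1)[OF assms] Rayleigh_le_lambda_max[OF assms] order_trans
    by blast
  moreover have "0 < (1 :: real^'n) \<bullet> 1" by simp
  ultimately show ?thesis by (simp only: mult_le_cancel_right_pos)
qed

text \<open>With \<open>z = M\<^sup>1\<^sup>/\<^sup>2 x\<close>, the Rayleigh quotient of the congruent matrix \<open>N\<close> at \<open>z\<close> is the
  generalised quotient \<open>(x \<bullet> K x) / (x \<bullet> M x)\<close>. This eliminates the square roots from the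
  definitions of \<open>\<alpha>\<^sub>F\<close>, \<open>\<beta>\<^sub>F\<close> and \<open>\<beta>\<^sub>N\<^sub>E\<close>.\<close>

lemma inv_sqrt_congruence:
  assumes M: "pos_def M" and K: "transpose K = K"
  defines "N \<equiv> inv_sqrt M ** K ** inv_sqrt M"
  shows "transpose N = N"
    and "x \<bullet> (K *v x) \<le> lambda_max N * (x \<bullet> (M *v x))"
    and "lambda_min N * (x \<bullet> (M *v x)) \<le> x \<bullet> (K *v x)"
    and "pos_def K \<Longrightarrow> 0 < lambda_min N"
proof -
  note R = inv_sqrt[OF M] and S = mat_sqrt[OF pos_def_imp_pos_semidef[OF M]]
  show N: "transpose N = N"
    by (simp add: N_def matrix_transpose_mul R K matrix_mul_assoc)
  have form: "z \<bullet> (N *v z) = (inv_sqrt M *v z) \<bullet> (K *v (inv_sqrt M *v z))" for z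
    using symmetric_dot_commute[OF R(1)]
    by (simp add: N_def matrix_vector_mul_assoc[symmetric])
  define z where "z = mat_sqrt M *v x"
  have x: "inv_sqrt M *v z = x" by (simp add: z_def matrix_vector_mul_assoc R)
  have zz: "z \<bullet> z = x \<bullet> (M *v x)"
    using symmetric_dot_commute[of "mat_sqrt M" x z] S
    by (simp add: z_def pos_semidef_def matrix_vector_mul_assoc)
  show "x \<bullet> (K *v x) \<le> lambda_max N * (x \<bullet> (M *v x))"
    using Rayleigh_le_lambda_max[OF N, of z] by (simp add: form x zz)
  show "lambda_min N * (x \<bullet> (M *v x)) \<le> x \<bullet> (K *v x)"
    using lambda_min_le_Rayleigh(1)[OF N, of z] by (simp add: form x zz)
  show "0 < lambda_min N" if "pos_def K"
  proof -
    obtain v where v: "v \<noteq> 0" "N *v v = lambda_min N *\<^sub>R v"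
      using lambda_min_le_Rayleigh(2)[OF N] by (auto simp: eigenvalue_def scalar_mult_eq_scaleR)
    have "mat_sqrt M ** inv_sqrt M = mat 1" using R(2) by (simp add: matrix_left_right_inverse)
    then have "mat_sqrt M *v (inv_sqrt M *v v) = v" by (simp add: matrix_vector_mul_assoc)
    then have "inv_sqrt M *v v \<noteq> 0" using v(1) by (metis matrix_vector_mult_0_right)
    then have "0 < v \<bullet> (N *v v)" unfolding form by (rule pos_def_pos[OF that])
    then have "0 < lambda_min N * (v \<bullet> v)" using v(2) by simp
    then show ?thesis by (metis inner_ge_zero not_less zero_less_mult_iff)
  qed
qed

section \<open>Block matrices\<close>

definition upper_part :: "'a^('n::finite + 'm::finite) \<Rightarrow> 'a^'n" where
  "upper_part v = (\<chi> i. v $ Inl i)"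

definition lower_part :: "'a^('n::finite + 'm::finite) \<Rightarrow> 'a^'m" where
  "lower_part v = (\<chi> i. v $ Inr i)"

lemma upper_lower_eq_iff:
  "v = w \<longleftrightarrow> upper_part v = upper_part w \<and> lower_part v = lower_part w"
  by (simp add: upper_part_def lower_part_def vec_eq_iff split_sum_all)

lemma sum_UNIV_sum_type:
  fixes g :: "'n::finite + 'm::finite \<Rightarrow> 'a::comm_monoid_add"
  shows "sum g UNIV = (\<Sum>i\<in>UNIV. g (Inl i)) + (\<Sum>j\<in>UNIV. g (Inr j))"
  by (simp add: UNIV_Plus_UNIV[symmetric] sum.Plus del: UNIV_Plus_UNIV)

lemma inner_upper_lower:
  fixes v w :: "real^('n::finite + 'm::finite)"
  shows "v \<bullet> w = upper_part v \<bullet> upper_part w + lower_part v \<bullet> lower_part w"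
  by (simp add: inner_vec_def sum_UNIV_sum_type upper_part_def lower_part_def)

lemma block_matrix_mult:
  shows "upper_part (block_matrix B11 B12 B21 B22 *v v)
      = B11 *v upper_part v + B12 *v lower_part v"
    and "lower_part (block_matrix B11 B12 B21 B22 *v v)
      = B21 *v upper_part v + B22 *v lower_part v"
  by (simp_all add: vec_eq_iff matrix_vector_mult_def sum_UNIV_sum_type block_matrix_def
      upper_part_def lower_part_def)

lemma transpose_block_matrix:
  "transpose (block_matrix B11 B12 B21 B22)
    = block_matrix (transpose B11) (transpose B21) (transpose B12) (transpose B22)"
  by (simp add: vec_eq_iff transpose_def block_matrix_def split_sum_all)

lemma pos_def_block_diagonal:
  fixes F :: "real^'n^'n" and P :: "real^'m^'m"
  assumes "pos_def F" and "pos_def P"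
  shows "pos_def (block_matrix F 0 0 P)"
  unfolding pos_def_def
proof (intro conjI allI impI)
  have "transpose (0 :: real^'m^'n) = 0" "transpose (0 :: real^'n^'m) = 0"
    by (simp_all add: vec_eq_iff transpose_def)
  then show "transpose (block_matrix F 0 0 P) = block_matrix F 0 0 P"
    by (simp add: transpose_block_matrix pos_def_symmetric assms)
  fix v :: "real^('n + 'm)"
  assume "v \<noteq> 0"
  then have "upper_part v \<noteq> 0 \<or> lower_part v \<noteq> 0"
    by (simp add: upper_lower_eq_iff) (simp add: upper_part_def lower_part_def vec_eq_iff)
  then show "0 < v \<bullet> (block_matrix F 0 0 P *v v)"
    using pos_def_pos[OF assms(1)] pos_def_pos[OF assms(2)]
      pos_def_nonneg[OF assms(1)] pos_def_nonneg[OF assms(2)]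
    by (auto simp: inner_upper_lower block_matrix_mult intro: add_pos_nonneg add_nonneg_pos)
qed

section \<open>The spectrum of a preconditioned symmetric matrix\<close>

text \<open>Split a complex eigenvector into \<open>u + i w\<close> and the eigenvalue into \<open>a + i b\<close>. Comparing
  \<open>w \<bullet> M u\<close> with \<open>u \<bullet> M w\<close>, which agree by symmetry, leaves
  \<open>b (u \<bullet> P u + w \<bullet> P w) = 0\<close>; so \<open>b = 0\<close>, and \<open>u\<close> or \<open>w\<close> is a real eigenvector.\<close>

lemma spectrum_pos_def_inverse_mult_symmetric:
  fixes P M :: "real^'n^'n"
  assumes P: "pos_def P" and M: "transpose M = M"
    and l: "l \<in> spectrum (matrix_inv P ** M)"
  obtains r v where "l = complex_of_real r" "v \<noteq> 0" "M *v v = r *\<^sub>R (P *v v)"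
proof -
  let ?N = "matrix_inv P ** M"
  obtain z where z: "z \<noteq> 0" "map_matrix complex_of_real ?N *v z = l *s z"
    using l by (auto simp: spectrum_def eigenvalue_def)
  define u w where "u = (\<chi> i. Re (z $ i))" and "w = (\<chi> i. Im (z $ i))"
  define a b where "a = Re l" and "b = Im l"
  have PN: "P ** ?N = M"
    by (simp add: matrix_mul_assoc invertible_matrix_inv pos_def_invertible P)
  have comp: "(\<Sum>j\<in>UNIV. complex_of_real (?N $ i $ j) * z $ j) = l * z $ i" for i
    using arg_cong[OF z(2), of "\<lambda>x. x $ i"] by (simp add: matrix_vector_mult_def)
  have "?N *v u = a *\<^sub>R u - b *\<^sub>R w"
    using arg_cong[OF comp, of Re]
    by (simp add: vec_eq_iff matrix_vector_mult_def u_def w_def a_def b_def)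
  then have Mu: "M *v u = a *\<^sub>R (P *v u) - b *\<^sub>R (P *v w)"
    by (subst PN[symmetric])
      (simp add: matrix_vector_mul_assoc[symmetric] matrix_vector_mult_diff_distrib
        matrix_vector_mult_scaleR)
  have "?N *v w = b *\<^sub>R u + a *\<^sub>R w"
    using arg_cong[OF comp, of Im]
    by (simp add: vec_eq_iff matrix_vector_mult_def u_def w_def a_def b_def add.commute)
  then have Mw: "M *v w = b *\<^sub>R (P *v u) + a *\<^sub>R (P *v w)"
    by (subst PN[symmetric])
      (simp add: matrix_vector_mul_assoc[symmetric] matrix_vector_right_distrib
        matrix_vector_mult_scaleR)
  have "w \<bullet> (M *v u) = u \<bullet> (M *v w)" "w \<bullet> (P *v u) = u \<bullet> (P *v w)"
    using symmetric_dot_commute[OF M] symmetric_dot_commute[OF pos_def_symmetric[OF P]]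
    by (metis inner_commute)+
  then have "b * (u \<bullet> (P *v u) + w \<bullet> (P *v w)) = 0"
    unfolding Mu Mw by (simp add: inner_diff_right inner_add_right algebra_simps)
  moreover have uw: "u \<noteq> 0 \<or> w \<noteq> 0"
    using z(1) by (auto simp: u_def w_def vec_eq_iff complex_eq_iff)
  moreover have "0 < u \<bullet> (P *v u) + w \<bullet> (P *v w)"
    using uw pos_def_pos[OF P] pos_def_nonneg[OF P] by (auto intro: add_pos_nonneg add_nonneg_pos)
  ultimately have "b = 0" by simp
  then have "l = complex_of_real a" by (simp add: a_def b_def complex_eq_iff)
  moreover have "M *v u = a *\<^sub>R (P *v u)" "M *v w = a *\<^sub>R (P *v w)"
    using Mu Mw \<open>b = 0\<close> by simp_all
  ultimately show ?thesis using uw that by blast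
qed

section \<open>Eigenvalue bounds for the saddle point problem\<close>

text \<open>The numbers stand for the quadratic forms named in the introduction. Substituting
  \<open>s = r p - e\<close> into the bounds on \<open>w\<close> gives inequalities between \<open>r\<close> and \<open>e / p \<in> (0, 1]\<close>.
  For the lower end, \<open>r + \<beta> < 1\<close> already gives \<open>r \<ge> 1\<close>, and otherwise the worst case is
  \<open>e = 0\<close>, which leaves \<open>r (r + \<beta>) \<ge> 1\<close>. For the upper end with \<open>r > 1\<close> the worst case is
  \<open>e = p\<close>, which leaves \<open>r\<^sup>2 - r + 1 \<le> B\<close>.\<close>

lemma positive_branch_bounds:
  fixes r \<alpha> \<beta> B s w e p :: real
  assumes r: "- \<alpha> < r" and \<alpha>: "0 < \<alpha>" "\<alpha> \<le> \<beta>"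
    and w: "0 \<le> w" "(r + \<alpha>) * s \<le> w" "w \<le> (r + \<beta>) * s"
    and e: "0 < e" "e \<le> p" and p: "p \<le> w + e" "w + e \<le> B * p"
    and eq: "s + e = r * p"
  shows "1 / (1 + \<beta>) \<le> r" and "r \<le> 1 + sqrt (B - 1)"
proof -
  have "0 < p" using e by simp
  have "0 < r + \<beta>" using r \<alpha> by simp
  then have "0 \<le> s" using w by (metis mult_less_0_iff not_less order_trans)
  then have "0 < r * p" using eq e by simp
  then have "0 < r" using \<open>0 < p\<close> by (simp add: zero_less_mult_iff)
  have s: "s = r * p - e" using eq by simp
  show "1 / (1 + \<beta>) \<le> r"
  proof (rule ccontr)
    assume "\<not> 1 / (1 + \<beta>) \<le> r"
    then have c: "r * (1 + \<beta>) < 1" using \<alpha> by (simp add: field_simps)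
    moreover have "0 < r * \<beta>" using \<open>0 < r\<close> \<alpha> by simp
    ultimately have "r < 1" by (simp add: algebra_simps)
    have main: "p - e \<le> (r + \<beta>) * s" using w p by simp
    show False
    proof (cases "1 \<le> r + \<beta>")
      case True
      then have "1 * e \<le> (r + \<beta>) * e" using e by (intro mult_right_mono) auto
      then have "1 * p \<le> ((r + \<beta>) * r) * p" using main by (simp add: s algebra_simps)
      then have "1 \<le> (r + \<beta>) * r" using \<open>0 < p\<close> by (simp only: mult_le_cancel_right_pos)
      moreover have "r * r \<le> r" using \<open>r < 1\<close> \<open>0 < r\<close> by (simp add: mult_le_cancel_left2)
      ultimately show False using c by (simp add: algebra_simps)
    next
      case False
      then have "(r + \<beta>) * s \<le> 1 * s" using \<open>0 \<le> s\<close> by (intro mult_right_mono) auto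
      then have "1 * p \<le> r * p" using main s by simp
      then show False using \<open>0 < p\<close> \<open>r < 1\<close> by (simp only: mult_le_cancel_right_pos)
    qed
  qed
  show "r \<le> 1 + sqrt (B - 1)"
  proof (cases "r \<le> 1")
    case True
    have "1 * p \<le> B * p" using p by simp
    then have "1 \<le> B" using \<open>0 < p\<close> by (simp only: mult_le_cancel_right_pos)
    then show ?thesis using True by (simp add: add_increasing2)
  next
    case False
    have "0 \<le> \<alpha> * s" using \<alpha> \<open>0 \<le> s\<close> by simp
    then have "r * s \<le> B * p - e" using w p by (simp add: algebra_simps)
    moreover have "e * (r - 1) \<le> p * (r - 1)" using e False by (intro mult_right_mono) auto
    ultimately have "(r * r - r + 1) * p \<le> B * p" by (simp add: s algebra_simps)
    then have "r * r - r + 1 \<le> B" using \<open>0 < p\<close> by (simp only: mult_le_cancel_right_pos)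
    \<comment> \<open>for \<open>r > 1\<close>, \<open>(r - 1)\<^sup>2\<close> is at most \<open>r\<^sup>2 - r\<close>\<close>
    then have "(r - 1)\<^sup>2 \<le> B - 1" using False by (simp add: power2_eq_square algebra_simps)
    then have "r - 1 \<le> sqrt (B - 1)" by (rule real_le_rsqrt)
    then show ?thesis by simp
  qed
qed

text \<open>Here \<open>r\<close> is the Rayleigh quotient of the whole saddle point matrix, with \<open>g = x \<bullet> F x\<close>. The
  term \<open>e\<close> can only raise it, and the mixed term \<open>2 s\<close> is controlled by the inequality of
  arithmetic and geometric means.\<close>

lemma negative_branch_bound:
  fixes r \<beta> B f g s w e p :: real
  assumes eq: "r * (f + p) = 2 * s - g + e"
    and nn: "0 \<le> f" "0 \<le> p" "0 < f + p" "0 \<le> e" "0 \<le> w" "0 \<le> B" and \<beta>: "0 \<le> \<beta>"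
    and g: "g \<le> \<beta> * f" and s: "s\<^sup>2 \<le> f * w" and w: "w \<le> B * p"
  shows "- \<beta> - sqrt B \<le> r"
proof -
  have "s\<^sup>2 \<le> f * (B * p)" using s w nn by (meson mult_left_mono order_trans)
  then have "\<bar>s\<bar> \<le> sqrt (B * (f * p))"
    by (intro real_le_rsqrt) (simp add: mult_ac)
  also have "\<dots> = sqrt B * sqrt (f * p)" by (rule real_sqrt_mult)
  also have "\<dots> \<le> sqrt B * ((f + p) / 2)"
    using arith_geo_mean_sqrt[of f p] nn by (intro mult_left_mono) auto
  finally have "- 2 * s \<le> sqrt B * (f + p)" by simp
  moreover have "\<beta> * f \<le> \<beta> * (f + p)" using nn \<beta> by (intro mult_left_mono) auto
  ultimately have "(- \<beta> - sqrt B) * (f + p) \<le> r * (f + p)"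
    using eq g nn by (simp add: algebra_simps)
  then show ?thesis using nn by (simp only: mult_le_cancel_right_pos)
qed

lemma Cauchy_Schwarz_pos_semidef:
  assumes "pos_semidef M"
  shows "(x \<bullet> (M *v y))\<^sup>2 \<le> (x \<bullet> (M *v x)) * (y \<bullet> (M *v y))"
  using assms symmetric_dot_commute[of M]
  by (intro Cauchy_Schwarz_psd_form[where S = UNIV]) (auto simp: pos_semidef_def)

text \<open>The analytic core, stated for arbitrary \<open>F\<close>, \<open>Ft\<close> and \<open>P\<close> that satisfy
  \<open>\<alpha> Ft \<le> F \<le> \<beta> Ft\<close> and \<open>\<delta> I \<le> P \<le> A Ft\<^sup>-\<^sup>1 A\<^sup>T + \<delta> I \<le> B P\<close>.\<close>

lemma saddle_point_eigenvalue_bounds: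
  fixes A :: "real^'n^'m" and F Ft :: "real^'n^'n" and P :: "real^'m^'m"
    and \<alpha> \<beta> B \<delta> r :: real
  assumes F: "transpose F = F" and Ft: "pos_def Ft" and P: "pos_def P"
    and \<alpha>: "0 < \<alpha>" "\<alpha> \<le> \<beta>" and \<delta>: "0 < \<delta>"
    and lo: "\<And>x. \<alpha> * (x \<bullet> (Ft *v x)) \<le> x \<bullet> (F *v x)"
    and up: "\<And>x. x \<bullet> (F *v x) \<le> \<beta> * (x \<bullet> (Ft *v x))"
    and P\<delta>: "\<And>y. \<delta> * (y \<bullet> y) \<le> y \<bullet> (P *v y)"
    and PM: "\<And>y. y \<bullet> (P *v y)
      \<le> (transpose A *v y) \<bullet> (matrix_inv Ft *v (transpose A *v y)) + \<delta> * (y \<bullet> y)"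
    and MP: "\<And>y. (transpose A *v y) \<bullet> (matrix_inv Ft *v (transpose A *v y)) + \<delta> * (y \<bullet> y)
      \<le> B * (y \<bullet> (P *v y))"
    and nz: "x \<noteq> 0 \<or> y \<noteq> 0"
    and eqx: "- F *v x + transpose A *v y = r *\<^sub>R (Ft *v x)"
    and eqy: "A *v x + \<delta> *\<^sub>R y = r *\<^sub>R (P *v y)"
  shows "r \<in> {- \<beta> - sqrt B .. - \<alpha>} \<union> {1 / (1 + \<beta>) .. 1 + sqrt (B - 1)}"
proof -
  define h u where "h = transpose A *v y" and "u = matrix_inv Ft *v h"
  define f g s w e p where "f = x \<bullet> (Ft *v x)" and "g = x \<bullet> (F *v x)" and "s = x \<bullet> h"
    and "w = h \<bullet> u" and "e = \<delta> * (y \<bullet> y)" and "p = y \<bullet> (P *v y)"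
  have h: "Ft *v u = h"
    by (simp add: u_def matrix_vector_mul_assoc invertible_matrix_inv pos_def_invertible Ft)
  have wu: "w = u \<bullet> (Ft *v u)" by (simp add: w_def h inner_commute)
  have nn: "0 \<le> f" "0 \<le> w" "0 \<le> p" "0 \<le> e"
    using pos_def_nonneg[OF Ft] pos_def_nonneg[OF P] \<delta> by (simp_all add: f_def wu p_def e_def)
  have hx: "h = F *v x + r *\<^sub>R (Ft *v x)"
  proof -
    have "- F *v x = - (F *v x)"
      by (simp add: matrix_vector_mult_def vec_eq_iff sum_negf)
    then show ?thesis
      using eqx by (simp add: h_def algebra_simps del: transpose_matrix_vector)
  qed
  have sx: "s = g + r * f" by (simp add: s_def hx inner_add_right g_def f_def)
  have "y \<bullet> (A *v x) = s"
    using dot_matrix_mult_transpose[of y A x] by (simp only: s_def h_def inner_commute)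
  then have sy: "s + e = r * p"
    using arg_cong[OF eqy, of "\<lambda>z. y \<bullet> z"] by (simp add: inner_add_right e_def p_def)
  have sfw: "s\<^sup>2 \<le> f * w"
    using Cauchy_Schwarz_pos_semidef[OF pos_def_imp_pos_semidef[OF Ft], of x u]
    by (simp add: h s_def f_def wu)
  have pw: "e \<le> p" "p \<le> w + e" "w + e \<le> B * p"
    using P\<delta>[of y] PM[of y] MP[of y] by (simp_all add: e_def p_def w_def u_def h_def)
  show ?thesis
  proof (cases "r \<le> - \<alpha>")
    case True
    have "0 < f + p"
      using nz pos_def_pos[OF Ft, of x] pos_def_pos[OF P, of y] nn
      by (auto simp: f_def p_def intro: add_pos_nonneg add_nonneg_pos)
    \<comment> \<open>\<open>y\<close> may vanish here, so \<open>B \<ge> 0\<close> is read off from the vector of ones\<close>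
    moreover have "0 \<le> B"
    proof -
      have "0 < 1 \<bullet> (P *v 1)" by (rule pos_def_pos[OF P]) simp
      moreover have "1 \<bullet> (P *v 1) \<le> B * (1 \<bullet> (P *v 1))" using PM[of 1] MP[of 1] by simp
      ultimately show ?thesis by (metis not_less order_less_le_trans zero_less_mult_iff less_le_not_le)
    qed
    moreover have "r * (f + p) = 2 * s - g + e" using sx sy by (simp add: algebra_simps)
    moreover have "g \<le> \<beta> * f" using up by (simp add: g_def f_def)
    ultimately have "- \<beta> - sqrt B \<le> r"
      using nn sfw pw \<alpha> by (intro negative_branch_bound[of r f p s g e w B \<beta>]) auto
    then show ?thesis using True by simp
  next
    case False
    define H where "H = F + r *\<^sub>R Ft"
    have H: "z \<bullet> (H *v v) = z \<bullet> (F *v v) + r * (z \<bullet> (Ft *v v))" for z v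
      by (simp add: H_def matrix_vector_mult_add_rdistrib scaleR_matrix_vector_assoc[symmetric]
          inner_add_right)
    have Hlo: "(r + \<alpha>) * (z \<bullet> (Ft *v z)) \<le> z \<bullet> (H *v z)" for z
      using lo[of z] by (simp add: H algebra_simps)
    have Hup: "z \<bullet> (H *v z) \<le> (r + \<beta>) * (z \<bullet> (Ft *v z))" for z
      using up[of z] by (simp add: H algebra_simps)
    have "0 \<le> z \<bullet> (H *v z)" for z
      using Hlo[of z] pos_def_nonneg[OF Ft, of z] False by (smt (verit) mult_nonneg_nonneg)
    moreover have "transpose H = H"
      using F pos_def_symmetric[OF Ft] by (simp add: H_def vec_eq_iff transpose_def)
    ultimately have Hpsd: "pos_semidef H" by (simp add: pos_semidef_def)
    have Hx: "H *v x = h"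
      by (simp add: hx H_def matrix_vector_mult_add_rdistrib scaleR_matrix_vector_assoc)
    have sf: "(r + \<alpha>) * f \<le> s" using Hlo[of x] by (simp add: Hx f_def s_def)
    have "0 \<le> (r + \<alpha>) * f" using False nn by simp
    with sf have "0 \<le> s" by simp
    \<comment> \<open>The two bounds replace \<open>H\<^sup>-\<^sup>1 \<le> Gt / (r + \<alpha>)\<close> and \<open>Gt \<le> (r + \<beta>) H\<^sup>-\<^sup>1\<close>. The first is
      Cauchy--Schwarz for \<open>Ft\<close> at \<open>x\<close> and \<open>u = Gt A\<^sup>T y\<close>, the second the one for \<open>H\<close> at the
      same vectors, using \<open>w = u \<bullet> H x\<close>.\<close>
    have "(r + \<alpha>) * s \<le> w"
    proof (cases "s = 0")
      case False
      have "(r + \<alpha>) * s\<^sup>2 \<le> (r + \<alpha>) * (f * w)"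
        using sfw \<open>\<not> r \<le> - \<alpha>\<close> by (intro mult_left_mono) auto
      also have "\<dots> \<le> s * w" using mult_right_mono[OF sf nn(2)] by (simp add: mult.assoc)
      finally have "s * ((r + \<alpha>) * s) \<le> s * w" by (simp add: power2_eq_square mult_ac)
      then show ?thesis using False \<open>0 \<le> s\<close> by (simp only: mult_le_cancel_left_pos)
    qed (use nn in simp)
    moreover have "w \<le> (r + \<beta>) * s"
    proof (cases "w = 0")
      case True
      then show ?thesis using False \<alpha> \<open>0 \<le> s\<close> by simp
    next
      case False
      have "w\<^sup>2 \<le> (u \<bullet> (H *v u)) * s"
        using Cauchy_Schwarz_pos_semidef[OF Hpsd, of u x]
        by (simp add: Hx w_def s_def inner_commute)
      also have "\<dots> \<le> ((r + \<beta>) * w) * s"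
        using Hup[of u] \<open>0 \<le> s\<close> by (intro mult_right_mono) (simp_all add: wu)
      finally have "w * w \<le> w * ((r + \<beta>) * s)" by (simp add: power2_eq_square mult_ac)
      then show ?thesis using False nn by (simp only: mult_le_cancel_left_pos)
    qed
    moreover have "0 < e"
    proof -
      have "y \<noteq> 0"
      proof
        assume "y = 0"
        then have "s = 0" by (simp add: s_def h_def)
        moreover have "0 < f" using nz \<open>y = 0\<close> pos_def_pos[OF Ft] by (simp add: f_def)
        ultimately show False using sf False by (simp add: mult_le_0_iff)
      qed
      then show ?thesis using \<delta> by (simp add: e_def)
    qed
    ultimately have "1 / (1 + \<beta>) \<le> r" "r \<le> 1 + sqrt (B - 1)"
      using positive_branch_bounds[of \<alpha> r \<beta> w s e p B] False \<alpha> nn pw sy by auto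
    then show ?thesis by simp
  qed
qed

section \<open>Diagonal matrices and normal equations\<close>

definition diag_mat :: "('n \<Rightarrow> real) \<Rightarrow> real^'n^'n" where
  "diag_mat d = (\<chi> i j. if i = j then d i else 0)"

lemma diag_mat_mult: "diag_mat d *v x = (\<chi> i. d i * x $ i)"
  by (simp add: diag_mat_def matrix_vector_mult_def vec_eq_iff if_distrib[of "\<lambda>c. c * _"]
      cong: if_cong)

lemma inner_diag_mat: "x \<bullet> (diag_mat d *v x) = (\<Sum>i\<in>UNIV. d i * (x $ i)\<^sup>2)"
  by (simp add: diag_mat_mult inner_vec_def power2_eq_square mult_ac)

lemma transpose_diag_mat: "transpose (diag_mat d) = diag_mat d"
  by (auto simp: diag_mat_def transpose_def vec_eq_iff)

lemma pos_def_diag_mat: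
  assumes "\<And>i. 0 < d i"
  shows "pos_def (diag_mat d)"
  unfolding pos_def_def
proof (intro conjI allI impI)
  fix x :: "real^'a" assume "x \<noteq> 0"
  then obtain i where "x $ i \<noteq> 0" by (auto simp: vec_eq_iff)
  then have "0 < (\<Sum>i\<in>UNIV. d i * (x $ i)\<^sup>2)"
    using assms by (intro sum_pos2[of _ i]) (auto simp: less_imp_le)
  then show "0 < x \<bullet> (diag_mat d *v x)" by (simp add: inner_diag_mat)
qed (rule transpose_diag_mat)

lemma matrix_inv_diag_mat:
  assumes "\<And>i. d i \<noteq> 0"
  shows "matrix_inv (diag_mat d) = diag_mat (\<lambda>i. inverse (d i))"
  using assms
  by (intro matrix_inv_eqI)
    (simp add: matrix_eq matrix_vector_mul_assoc[symmetric] diag_mat_mult vec_eq_iff)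

lemma inner_congruence_plus_scalar:
  fixes A :: "real^'n^'m"
  shows "y \<bullet> ((A ** D ** transpose A + \<delta> *\<^sub>R mat 1) *v y)
    = (transpose A *v y) \<bullet> (D *v (transpose A *v y)) + \<delta> * (y \<bullet> y)"
  by (simp add: matrix_vector_mult_add_rdistrib scaleR_matrix_vector_assoc[symmetric]
      inner_add_right matrix_vector_mul_assoc[symmetric] dot_matrix_mult_transpose[of y A]
      del: transpose_matrix_vector)

lemma transpose_congruence_plus_scalar:
  fixes A :: "real^'n^'m"
  assumes "transpose D = D"
  shows "transpose (A ** D ** transpose A + \<delta> *\<^sub>R mat 1) = A ** D ** transpose A + \<delta> *\<^sub>R mat 1"
proof -
  have "transpose (X + \<delta> *\<^sub>R mat 1) = transpose X + \<delta> *\<^sub>R mat 1" for X :: "real^'m^'m"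
    by (auto simp: transpose_def vec_eq_iff mat_def)
  then show ?thesis by (simp add: matrix_transpose_mul assms matrix_mul_assoc)
qed

section \<open>The spectrum of the preconditioned augmented system\<close>

theorem theorem3:
  fixes A :: "real^'n^'m" and Q \<Theta> :: "real^'n^'n" and \<rho> \<delta> \<mu> C :: real
  assumes "pos_semidef Q"
    and "is_diag \<Theta>" and "\<forall>i. 0 < \<Theta> $ i $ i"
    and "0 < \<rho>" and "0 < \<delta>" and "0 < \<mu>" and "0 < C"
  shows "spectrum (matrix_inv (PAS_mat A Q \<Theta> \<rho> \<delta> \<mu> C) ** MAS_mat A Q \<Theta> \<rho> \<delta>)
    \<subseteq> complex_of_real `
        ({- beta_F Q \<Theta> \<rho> - sqrt (beta_NE A Q \<Theta> \<rho> \<delta> \<mu> C) .. - alpha_F Q \<Theta> \<rho>}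
         \<union> {1 / (1 + beta_F Q \<Theta> \<rho>) .. 1 + sqrt (beta_NE A Q \<Theta> \<rho> \<delta> \<mu> C - 1)})"
proof
  fix l
  assume l: "l \<in> spectrum (matrix_inv (PAS_mat A Q \<Theta> \<rho> \<delta> \<mu> C) ** MAS_mat A Q \<Theta> \<rho> \<delta>)"
  define F where "F = F_mat Q \<Theta> \<rho>"
  define Ft where "Ft = Ft_mat Q \<Theta> \<rho>"
  define P where "P = PNE_mat A Q \<Theta> \<rho> \<delta> \<mu> C"
  define M where "M = MNEt_mat A Q \<Theta> \<rho> \<delta>"
  \<comment> \<open>\<open>d\<close> and \<open>c\<close> are the diagonals of $\tilde F_k$ and $E_k$\<close>
  define d where "d i = Q $ i $ i + inverse (\<Theta> $ i $ i) + \<rho>" for i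
  define c where "c i = (if inverse (d i) < C * min \<mu> 1 then 0 else inverse (d i))" for i
  have Qdiag: "0 \<le> Q $ i $ i" for i
  proof -
    have "0 \<le> axis i 1 \<bullet> (Q *v axis i 1)" using assms(1) by (simp add: pos_semidef_def)
    then show ?thesis by (simp add: inner_axis' matrix_vector_mul_component inner_axis)
  qed
  have "\<Theta> = diag_mat (\<lambda>i. \<Theta> $ i $ i)"
    using assms(2) by (auto simp: is_diag_def diag_mat_def vec_eq_iff)
  then have \<Theta>inv: "matrix_inv \<Theta> = diag_mat (\<lambda>i. inverse (\<Theta> $ i $ i))"
    using assms(3) matrix_inv_diag_mat[of "\<lambda>i. \<Theta> $ i $ i"] by (metis less_irrefl)
  have dpos: "0 < d i" for i
  proof -
    have "0 < inverse (\<Theta> $ i $ i)" using assms(3) by simp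
    then show ?thesis unfolding d_def using Qdiag[of i] assms(4) by linarith
  qed
  have Ft_diag: "Ft = diag_mat d"
    unfolding Ft_def Ft_mat_def \<Theta>inv
    by (simp add: diag_mat_def diag_part_def d_def mat_def vec_eq_iff)
  have Ft: "pos_def Ft" unfolding Ft_diag by (rule pos_def_diag_mat) (rule dpos)
  have G: "matrix_inv Ft = diag_mat (\<lambda>i. inverse (d i))"
    unfolding Ft_diag using dpos by (intro matrix_inv_diag_mat) (metis less_irrefl)
  have Gt: "Gt_mat Q \<Theta> \<rho> = matrix_inv Ft" by (simp add: Gt_mat_def Ft_def)
  have E: "E_mat Q \<Theta> \<rho> \<mu> C = diag_mat c"
  proof -
    have "Gt_mat Q \<Theta> \<rho> $ i $ i = inverse (d i)" for i
      by (simp add: Gt G) (simp add: diag_mat_def)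
    then show ?thesis by (simp add: E_mat_def c_def diag_mat_def vec_eq_iff)
  qed
  have c: "0 \<le> c i" "c i \<le> inverse (d i)" for i
    using dpos[of i] by (simp_all add: c_def)
  have F: "pos_def F"
    unfolding pos_def_def
  proof (intro conjI allI impI)
    show "transpose F = F"
    proof -
      have "Q $ j $ i = Q $ i $ j" for i j
        using assms(1) unfolding pos_semidef_def by (metis transpose_def vec_lambda_beta)
      then show ?thesis
        unfolding F_def F_mat_def \<Theta>inv
        by (auto simp: vec_eq_iff transpose_def diag_mat_def mat_def)
    qed
    fix x :: "real^'n" assume "x \<noteq> 0"
    have "x \<bullet> (F *v x) = x \<bullet> (Q *v x) + x \<bullet> (matrix_inv \<Theta> *v x) + \<rho> * (x \<bullet> x)"
      by (simp add: F_def F_mat_def matrix_vector_mult_add_rdistrib inner_add_right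
          scaleR_matrix_vector_assoc[symmetric])
    moreover have "0 \<le> x \<bullet> (Q *v x)" using assms(1) by (simp add: pos_semidef_def)
    moreover have "0 \<le> x \<bullet> (matrix_inv \<Theta> *v x)"
      unfolding \<Theta>inv using assms(3) by (intro pos_def_nonneg pos_def_diag_mat) simp
    moreover have "0 < \<rho> * (x \<bullet> x)" using assms(4) \<open>x \<noteq> 0\<close> by simp
    ultimately show "0 < x \<bullet> (F *v x)" by simp
  qed
  have Pq: "y \<bullet> (P *v y)
      = (transpose A *v y) \<bullet> (diag_mat c *v (transpose A *v y)) + \<delta> * (y \<bullet> y)" for y
    unfolding P_def PNE_mat_def E by (rule inner_congruence_plus_scalar)
  have Mq: "y \<bullet> (M *v y)
      = (transpose A *v y) \<bullet> (matrix_inv Ft *v (transpose A *v y)) + \<delta> * (y \<bullet> y)" for y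
    unfolding M_def MNEt_mat_def Gt by (rule inner_congruence_plus_scalar)
  have P\<delta>: "\<delta> * (y \<bullet> y) \<le> y \<bullet> (P *v y)" for y
    unfolding Pq inner_diag_mat using c by (simp add: sum_nonneg)
  have PM: "y \<bullet> (P *v y) \<le> y \<bullet> (M *v y)" for y
    unfolding Pq Mq G inner_diag_mat using c by (simp add: sum_mono mult_right_mono)
  have "transpose P = P"
    unfolding P_def PNE_mat_def E by (intro transpose_congruence_plus_scalar transpose_diag_mat)
  moreover have "0 < y \<bullet> (P *v y)" if "y \<noteq> 0" for y
  proof -
    have "0 < \<delta> * (y \<bullet> y)" using assms(5) that by simp
    then show ?thesis using P\<delta>[of y] by simp
  qed
  ultimately have P: "pos_def P" by (simp add: pos_def_def)
  have M: "transpose M = M"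
    unfolding M_def MNEt_mat_def Gt G
    by (intro transpose_congruence_plus_scalar transpose_diag_mat)
  note cF = inv_sqrt_congruence[OF Ft pos_def_symmetric[OF F]]
  note cM = inv_sqrt_congruence[OF P M]
  have hats: "alpha_F Q \<Theta> \<rho> = lambda_min (inv_sqrt Ft ** F ** inv_sqrt Ft)"
    "beta_F Q \<Theta> \<rho> = lambda_max (inv_sqrt Ft ** F ** inv_sqrt Ft)"
    "beta_NE A Q \<Theta> \<rho> \<delta> \<mu> C = lambda_max (inv_sqrt P ** M ** inv_sqrt P)"
    by (simp_all add: alpha_F_def beta_F_def beta_NE_def Fh_mat_def MNEh_mat_def
        F_def Ft_def P_def M_def)
  have PAS: "PAS_mat A Q \<Theta> \<rho> \<delta> \<mu> C = block_matrix Ft 0 0 P"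
    by (simp add: PAS_mat_def Ft_def P_def)
  have MAS: "MAS_mat A Q \<Theta> \<rho> \<delta> = block_matrix (- F) (transpose A) A (\<delta> *\<^sub>R mat 1)"
    by (simp add: MAS_mat_def F_def)
  have "transpose (- F) = - F" "transpose (\<delta> *\<^sub>R mat 1 :: real^'m^'m) = \<delta> *\<^sub>R mat 1"
    using pos_def_symmetric[OF F] by (auto simp: transpose_def vec_eq_iff mat_def)
  then have MAS_sym: "transpose (MAS_mat A Q \<Theta> \<rho> \<delta>) = MAS_mat A Q \<Theta> \<rho> \<delta>"
    by (simp add: MAS transpose_block_matrix)
  obtain r v where lr: "l = complex_of_real r" and "v \<noteq> 0"
    and v: "MAS_mat A Q \<Theta> \<rho> \<delta> *v v = r *\<^sub>R (block_matrix Ft 0 0 P *v v)"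
    using spectrum_pos_def_inverse_mult_symmetric[OF pos_def_block_diagonal[OF Ft P] MAS_sym] l
    unfolding PAS by blast
  define x y where "x = upper_part v" and "y = lower_part v"
  have scale: "upper_part (r *\<^sub>R z) = r *\<^sub>R upper_part z"
    "lower_part (r *\<^sub>R z) = r *\<^sub>R lower_part z" for z :: "real^('n + 'm)"
    by (simp_all add: upper_part_def lower_part_def vec_eq_iff)
  have xy: "x \<noteq> 0 \<or> y \<noteq> 0"
    using \<open>v \<noteq> 0\<close> by (auto simp: x_def y_def upper_part_def lower_part_def vec_eq_iff split_sum_all)
  have eqx: "- F *v x + transpose A *v y = r *\<^sub>R (Ft *v x)"
    using arg_cong[OF v, of upper_part] by (simp add: MAS block_matrix_mult scale x_def y_def)
  have eqy: "A *v x + \<delta> *\<^sub>R y = r *\<^sub>R (P *v y)"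
    using arg_cong[OF v, of lower_part]
    by (simp add: MAS block_matrix_mult scale x_def y_def scaleR_matrix_vector_assoc[symmetric])
  have "r \<in> {- beta_F Q \<Theta> \<rho> - sqrt (beta_NE A Q \<Theta> \<rho> \<delta> \<mu> C) .. - alpha_F Q \<Theta> \<rho>}
         \<union> {1 / (1 + beta_F Q \<Theta> \<rho>) .. 1 + sqrt (beta_NE A Q \<Theta> \<rho> \<delta> \<mu> C - 1)}"
  proof (rule saddle_point_eigenvalue_bounds[OF pos_def_symmetric[OF F] Ft P _ _ assms(5)
        _ _ P\<delta> _ _ xy eqx eqy])
    show "0 < alpha_F Q \<Theta> \<rho>" unfolding hats by (rule cF(4)[OF F])
    show "alpha_F Q \<Theta> \<rho> \<le> beta_F Q \<Theta> \<rho>"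
      unfolding hats by (rule lambda_min_le_lambda_max[OF cF(1)])
    show "alpha_F Q \<Theta> \<rho> * (x \<bullet> (Ft *v x)) \<le> x \<bullet> (F *v x)" for x
      unfolding hats by (rule cF(3))
    show "x \<bullet> (F *v x) \<le> beta_F Q \<Theta> \<rho> * (x \<bullet> (Ft *v x))" for x
      unfolding hats by (rule cF(2))
  qed (use PM cM(2) in \<open>auto simp only: Mq hats\<close>)
  then show "l \<in> complex_of_real `
        ({- beta_F Q \<Theta> \<rho> - sqrt (beta_NE A Q \<Theta> \<rho> \<delta> \<mu> C) .. - alpha_F Q \<Theta> \<rho>}
         \<union> {1 / (1 + beta_F Q \<Theta> \<rho>) .. 1 + sqrt (beta_NE A Q \<Theta> \<rho> \<delta> \<mu> C - 1)})"
    unfolding lr by (rule imageI)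
qed

end
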